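(* Let $\mathbb P$ be a rider piece with basic move set $\mathbf M=\{(c_r,d_r):1\le r\le|\mathbf M|\}$. Put $\hat c_r:=\min(|c_r|,|d_r|)$, $\hat d_r:=\max(|c_r|,|d_r|)$, and $\bar n_r:=(n\bmod\hat d_r)\in\{0,1,\dots,\hat d_r-1\}$. On the square board, $$\begin{aligned}u_{\mathbb P}(2;n)=\frac1{2!}o_{\mathbb P}(2;n)={}&\frac12n^4-\frac16\sum_{r=1}^{|\mathbf M|}\frac{3\hat d_r-\hat c_r}{\hat d_r^2}\,n^3+\frac{|\mathbf M|-1}{2}\,n^2-\frac16\sum_{r=1}^{|\mathbf M|}\hat c_r\,n\\&-\frac12\sum_{r=1}^{|\mathbf M|}\frac{\bar n_r(\hat d_r-\bar n_r)(\hat d_r-\hat c_r)}{\hat d_r^2}\,n+\frac16\sum_{r=1}^{|\mathbf M|}\frac{\hat c_r(\hat d_r-\bar n_r)(\hat d_r-2\bar n_r)\bar n_r}{\hat d_r^2}.\end{aligned}$$ The period of $u_{\mathbb P}(2;n)$ is $\Lambda:=\operatorname{lcm}\{\hat d_r:1\le r\le|\mathbf M|\}$.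
   Context: A rider piece $\mathbb P$ is given by a nonempty finite set $\mathbf M\subset\mathbb Z^2$ of nonzero, pairwise non-parallel vectors $(c,d)$ with $c,d$ relatively prime (the basic moves). The $n\times n$ board is $[n]^2=\{1,\dots,n\}^2$. Two pieces at positions $z,z'\in[n]^2$ attack each other if $z'-z$ is an integer multiple (possibly zero) of some element of $\mathbf M$. $o_{\mathbb P}(q;n)$ is the number of placements of $q$ labelled copies of $\mathbb P$ on $[n]^2$ with no two attacking; $u_{\mathbb P}(q;n)=o_{\mathbb P}(q;n)/q!$ is the number for unlabelled copies. For fixed $q$ these are quasipolynomials in $n$ (given by a cyclically repeating sequence of polynomials); the period is the smallest length of such a cycle. *)

theory Defs
  imports Complex_Main "HOL-Computational_Algebra.Polynomial" "HOL-Library.FuncSet"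
begin

definition rider_moves :: "(int \<times> int) set \<Rightarrow> bool" where
  "rider_moves M \<longleftrightarrow>
     finite M \<and> M \<noteq> {} \<and>
     (\<forall>(c, d) \<in> M. (c, d) \<noteq> (0, 0) \<and> coprime c d) \<and>
     (\<forall>(c, d) \<in> M. \<forall>(c', d') \<in> M. (c, d) \<noteq> (c', d') \<longrightarrow> c * d' \<noteq> c' * d)"

definition board :: "nat \<Rightarrow> (int \<times> int) set" where
  "board n = {1..int n} \<times> {1..int n}"

definition attacks :: "(int \<times> int) set \<Rightarrow> int \<times> int \<Rightarrow> int \<times> int \<Rightarrow> bool" where
  "attacks M z z' \<longleftrightarrow>
     (\<exists>(c, d) \<in> M. \<exists>k::int. fst z' - fst z = k * c \<and> snd z' - snd z = k * d)"

definition labelled_placements ::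
    "(int \<times> int) set \<Rightarrow> nat \<Rightarrow> nat \<Rightarrow> (nat \<Rightarrow> int \<times> int) set" where
  "labelled_placements M q n =
     {f \<in> {1..q} \<rightarrow>\<^sub>E board n. pairwise (\<lambda>i j. \<not> attacks M (f i) (f j)) {1..q}}"

definition unlabelled_placements ::
    "(int \<times> int) set \<Rightarrow> nat \<Rightarrow> nat \<Rightarrow> (int \<times> int) set set" where
  "unlabelled_placements M q n =
     {S. S \<subseteq> board n \<and> card S = q \<and> pairwise (\<lambda>z z'. \<not> attacks M z z') S}"

definition o_count :: "(int \<times> int) set \<Rightarrow> nat \<Rightarrow> nat \<Rightarrow> nat" where
  "o_count M q n = card (labelled_placements M q n)"

definition u_count :: "(int \<times> int) set \<Rightarrow> nat \<Rightarrow> nat \<Rightarrow> nat" where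
  "u_count M q n = card (unlabelled_placements M q n)"

text \<open>The board size ranges over the positive integers.\<close>

definition quasipoly_cycle :: "(nat \<Rightarrow> real) \<Rightarrow> nat \<Rightarrow> bool" where
  "quasipoly_cycle f p \<longleftrightarrow>
     p \<ge> 1 \<and> (\<exists>P :: nat \<Rightarrow> real poly. \<forall>n\<ge>1. f n = poly (P (n mod p)) (real n))"

definition has_quasipoly_period :: "(nat \<Rightarrow> real) \<Rightarrow> nat \<Rightarrow> bool" where
  "has_quasipoly_period f p \<longleftrightarrow>
     quasipoly_cycle f p \<and> (\<forall>p'. quasipoly_cycle f p' \<longrightarrow> p \<le> p')"

definition c_hat :: "int \<times> int \<Rightarrow> nat" where
  "c_hat m = nat (min \<bar>fst m\<bar> \<bar>snd m\<bar>)"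

definition d_hat :: "int \<times> int \<Rightarrow> nat" where
  "d_hat m = nat (max \<bar>fst m\<bar> \<bar>snd m\<bar>)"

definition n_bar :: "nat \<Rightarrow> int \<times> int \<Rightarrow> nat" where
  "n_bar n m = n mod d_hat m"

end

theory Submission
  imports Defs
begin

text \<open>
  Since attacking is reflexive and symmetric, two labelled nonattacking pieces are an ordered pair
  of nonattacking squares, and each unlabelled placement comes from exactly two of them. So it
  suffices to count the attacking ordered pairs, which are sorted by their displacement. Displacement
  zero contributes \<open>n\<^sup>2\<close> pairs. Because the moves are pairwise non-parallel, a nonzero
  displacement is \<open>k m\<close> for at most one move \<open>m\<close> and one integer \<open>k\<close>, and the number of
  pairs with that displacement is the number of positions of a
  \<open>\<bar>k\<bar> \<cdot> c_hat m\<close> by \<open>\<bar>k\<bar> \<cdot> d_hat m\<close> rectangle in the board, namely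
  \<open>(n - \<bar>k\<bar> \<cdot> c_hat m) (n - \<bar>k\<bar> \<cdot> d_hat m)\<close> as long as \<open>\<bar>k\<bar> \<le> n div d_hat m\<close>
  (\<open>card_attacking_pairs\<close>). Summing over \<open>k\<close> and writing \<open>n\<close> as quotient times
  \<open>d_hat m\<close> plus remainder gives the formula
  (\<open>sum_displacements_closed_form\<close>, \<open>u_count_2_eq_constituent\<close>).

  The coefficients depend on \<open>n\<close> only through its residues modulo the \<open>d_hat m\<close>, so the least common
  multiple of the \<open>d_hat m\<close> is the length of a cycle. For minimality, the constituent polynomials
  of a quasipolynomial are determined by its values (\<open>quasipoly_constituents_unique\<close>), so if \<open>p\<close> is
  the length of a cycle, then the constituents belonging to \<open>p\<close> and to \<open>0\<close> coincide. Their linear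
  coefficients differ by a sum of nonnegative multiples of \<open>r (d_hat m - r)\<close>, where \<open>r\<close> is the
  remainder of \<open>p\<close> modulo \<open>d_hat m\<close>. No cancellation between different moves is
  possible in this sum, so each remainder vanishes and every \<open>d_hat m\<close> divides \<open>p\<close>
  (\<open>d_hat_dvd_if_constituent_eq\<close>).
\<close>

section \<open>Ordered and unordered pairs\<close>

text \<open>
  To order a two-element set is to choose one of its members as the first, so the ordered pairs
  correspond to the sets \<open>S\<close> with a chosen element.
\<close>

lemma card_ordered_pairs_eq_twice_unordered:
  assumes fin: "finite A"
    and sym: "\<And>x y. R x y \<Longrightarrow> R y x"
    and irrefl: "\<And>x. x \<in> A \<Longrightarrow> \<not> R x x"
  shows "card {(x, y) \<in> A \<times> A. R x y} =
         2 * card {S. S \<subseteq> A \<and> card S = 2 \<and> pairwise R S}"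
    (is "card ?N = 2 * card ?U")
proof -
  have "bij_betw (\<lambda>(x, y). ({x, y}, x)) ?N (SIGMA S:?U. S)"
  proof (rule bij_betwI')
    fix p q assume "p \<in> ?N" "q \<in> ?N"
    then show "((\<lambda>(x, y). ({x, y}, x)) p = (\<lambda>(x, y). ({x, y}, x)) q) = (p = q)"
      by (auto simp: doubleton_eq_iff)
  next
    fix p assume p: "p \<in> ?N"
    obtain x y where xy: "p = (x, y)" by force
    have "x \<noteq> y" using p irrefl xy by auto
    then have "card {x, y} = 2" by simp
    moreover have "pairwise R {x, y}"
      using p xy sym by (auto simp: pairwise_def)
    ultimately show "(\<lambda>(x, y). ({x, y}, x)) p \<in> (SIGMA S:?U. S)"
      using p xy by auto
  next
    fix s assume "s \<in> (SIGMA S:?U. S)"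
    then obtain S x where s: "s = (S, x)" and S: "S \<subseteq> A" "card S = 2" "pairwise R S" and x: "x \<in> S"
      by auto
    obtain y where y: "S = {x, y}" "x \<noteq> y"
      using S(2) x by (auto simp: card_2_iff)
    have "(x, y) \<in> ?N" using S y by (auto simp: pairwise_def)
    then show "\<exists>p\<in>?N. s = (\<lambda>(x, y). ({x, y}, x)) p"
      using s y by force
  qed
  then have "card ?N = card (SIGMA S:?U. S)" by (rule bij_betw_same_card)
  also have "\<dots> = (\<Sum>S\<in>?U. card S)"
    using fin by (intro card_SigmaI) (auto intro: finite_subset)
  also have "\<dots> = (\<Sum>S\<in>?U. 2)" by (rule sum.cong) auto
  finally show ?thesis by simp
qed

lemma finite_board [simp]: "finite (board n)"
  by (simp add: board_def)

lemma card_board [simp]: "card (board n) = n ^ 2"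
  by (simp add: board_def card_cartesian_product power2_eq_square)

lemma attacks_sym: "attacks M z z' \<Longrightarrow> attacks M z' z"
proof -
  assume "attacks M z z'"
  then obtain c d k where m: "(c, d) \<in> M"
    and k: "fst z' - fst z = k * c" "snd z' - snd z = k * d"
    by (auto simp: attacks_def)
  have "fst z - fst z' = (- k) * c" "snd z - snd z' = (- k) * d" using k by auto
  then show ?thesis using m unfolding attacks_def by blast
qed

lemma attacks_refl: "M \<noteq> {} \<Longrightarrow> attacks M z z"
  unfolding attacks_def by (force intro: exI[of _ 0])

lemma o_count_2:
  "o_count M 2 n = card {(z, z') \<in> board n \<times> board n. \<not> attacks M z z'}"
proof -
  have two: "{1..2::nat} = {1, 2}" by auto
  have "bij_betw (\<lambda>f. (f 1, f 2)) (labelled_placements M 2 n)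
          {(z, z') \<in> board n \<times> board n. \<not> attacks M z z'}"
  proof (rule bij_betwI')
    fix f g assume f: "f \<in> labelled_placements M 2 n" and g: "g \<in> labelled_placements M 2 n"
    have "f = g" if "f 1 = g 1" "f 2 = g 2"
    proof (rule PiE_ext)
      show "f \<in> {1..2} \<rightarrow>\<^sub>E board n" "g \<in> {1..2} \<rightarrow>\<^sub>E board n"
        using f g by (auto simp: labelled_placements_def)
      show "f i = g i" if "i \<in> {1..2}" for i
        using that \<open>f 1 = g 1\<close> \<open>f 2 = g 2\<close> unfolding two by blast
    qed
    then show "((f 1, f 2) = (g 1, g 2)) = (f = g)" by auto
  next
    fix f assume "f \<in> labelled_placements M 2 n"
    then show "(f 1, f 2) \<in> {(z, z') \<in> board n \<times> board n. \<not> attacks M z z'}"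
      by (auto simp: labelled_placements_def two pairwise_def PiE_iff)
  next
    fix p assume p: "p \<in> {(z, z') \<in> board n \<times> board n. \<not> attacks M z z'}"
    define f where "f = (\<lambda>i\<in>{1..2::nat}. if i = 1 then fst p else snd p)"
    have "f \<in> labelled_placements M 2 n"
      using p attacks_sym[of M "snd p" "fst p"]
      by (auto simp: labelled_placements_def two pairwise_def PiE_iff f_def)
    moreover have "p = (f 1, f 2)" by (simp add: f_def)
    ultimately show "\<exists>f\<in>labelled_placements M 2 n. p = (f 1, f 2)" by blast
  qed
  then show ?thesis unfolding o_count_def by (rule bij_betw_same_card)
qed

lemma o_count_2_eq_twice_u_count_2:
  assumes "M \<noteq> {}"
  shows "o_count M 2 n = 2 * u_count M 2 n"
  unfolding o_count_2 u_count_def unlabelled_placements_def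
  by (rule card_ordered_pairs_eq_twice_unordered)
     (use attacks_refl[OF assms] attacks_sym in auto)

section \<open>Counting attacking pairs by displacement\<close>

definition displaced_pairs :: "nat \<Rightarrow> int \<Rightarrow> int \<Rightarrow> ((int \<times> int) \<times> (int \<times> int)) set" where
  "displaced_pairs n a b =
     {(z, z') \<in> board n \<times> board n. fst z' - fst z = a \<and> snd z' - snd z = b}"

lemma finite_displaced_pairs [simp]: "finite (displaced_pairs n a b)"
  by (rule finite_subset[of _ "board n \<times> board n"]) (auto simp: displaced_pairs_def)

lemma card_interval_inter_translate:
  "card {x \<in> {1..int n}. x + a \<in> {1..int n}} = n - nat \<bar>a\<bar>"
proof -
  have "{x \<in> {1..int n}. x + a \<in> {1..int n}} = {max 1 (1 - a)..min (int n) (int n - a)}"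
    by auto
  then show ?thesis by simp
qed

lemma card_displaced_pairs:
  "card (displaced_pairs n a b) = (n - nat \<bar>a\<bar>) * (n - nat \<bar>b\<bar>)"
proof -
  let ?I = "\<lambda>a. {x \<in> {1..int n}. x + a \<in> {1..int n}}"
  have "displaced_pairs n a b = (\<lambda>(x, y). ((x, y), (x + a, y + b))) ` (?I a \<times> ?I b)"
    by (force simp: displaced_pairs_def board_def image_iff)
  moreover have "inj_on (\<lambda>(x, y). ((x, y), (x + a, y + b))) (?I a \<times> ?I b)"
    by (auto simp: inj_on_def)
  ultimately have "card (displaced_pairs n a b) = card (?I a \<times> ?I b)"
    by (simp add: card_image)
  then show ?thesis by (simp only: card_cartesian_product card_interval_inter_translate)
qed

lemma card_displaced_pairs_move:
  "card (displaced_pairs n (k * fst m) (k * snd m)) =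
     (n - nat \<bar>k\<bar> * c_hat m) * (n - nat \<bar>k\<bar> * d_hat m)"
  by (cases "\<bar>fst m\<bar> \<le> \<bar>snd m\<bar>")
     (simp_all add: card_displaced_pairs c_hat_def d_hat_def abs_mult nat_mult_distrib mult.commute)

lemma d_hat_pos: "rider_moves M \<Longrightarrow> m \<in> M \<Longrightarrow> d_hat m > 0"
  unfolding rider_moves_def d_hat_def by (cases m) fastforce

lemma c_hat_le_d_hat: "c_hat m \<le> d_hat m"
  by (auto simp: c_hat_def d_hat_def)

text \<open>
  A diagonal move has coprime coordinates of equal absolute value, which must be 1. The strict
  inequality is what makes the linear coefficient of the count detect every modulus
  \<open>d_hat m > 1\<close>.
\<close>

lemma c_hat_less_d_hat:
  assumes "rider_moves M" "m \<in> M" "d_hat m \<noteq> 1"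
  shows "c_hat m < d_hat m"
proof (rule ccontr)
  assume "\<not> ?thesis"
  then have eq: "\<bar>fst m\<bar> = \<bar>snd m\<bar>" by (auto simp: c_hat_def d_hat_def)
  have "coprime (fst m) (snd m)" using assms by (auto simp: rider_moves_def)
  then have "coprime \<bar>fst m\<bar> \<bar>snd m\<bar>" by simp
  then have "\<bar>fst m\<bar> = 1" unfolding eq by simp
  then show False using eq assms(3) by (simp add: d_hat_def)
qed

text \<open>
  The cross product of \<open>k m\<close> and \<open>k' m'\<close> is \<open>k k'\<close> times that of \<open>m\<close> and \<open>m'\<close>, which is
  nonzero for distinct moves. Hence no pair of squares is counted under two displacements.
\<close>

lemma multiples_of_moves_inj:
  assumes M: "rider_moves M" and m: "m \<in> M" "m' \<in> M" and k: "k \<noteq> 0" "k' \<noteq> 0"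
    and eq: "k * fst m = k' * fst m'" "k * snd m = k' * snd m'"
  shows "m = m' \<and> k = k'"
proof -
  have "(k * fst m) * (k' * snd m') = (k' * fst m') * (k * snd m)"
    using eq by simp
  then have "(k * k') * (fst m * snd m' - fst m' * snd m) = 0"
    by (simp add: algebra_simps)
  then have "fst m * snd m' = fst m' * snd m" using k by simp
  then have "m = m'" using M m unfolding rider_moves_def by fastforce
  moreover have "fst m \<noteq> 0 \<or> snd m \<noteq> 0" using M m(1) unfolding rider_moves_def by (cases m) fastforce
  ultimately show ?thesis using eq by auto
qed

lemma sum_symmetric_interval:
  fixes g :: "nat \<Rightarrow> nat"
  shows "(\<Sum>k\<in>{- int n..int n} - {0}. g (nat \<bar>k\<bar>)) = 2 * (\<Sum>k=1..n. g k)"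
proof -
  have "{- int n..int n} - {0} = (int ` {1..n}) \<union> ((\<lambda>k. - int k) ` {1..n})"
    (is "_ = ?A \<union> ?B")
  proof (rule set_eqI)
    fix k
    show "k \<in> {- int n..int n} - {0} \<longleftrightarrow> k \<in> ?A \<union> ?B"
      by (cases k rule: int_cases2) (auto simp: image_iff)
  qed
  moreover have "?A \<inter> ?B = {}" by auto
  ultimately have "(\<Sum>k\<in>{- int n..int n} - {0}. g (nat \<bar>k\<bar>)) =
      (\<Sum>k\<in>?A. g (nat \<bar>k\<bar>)) + (\<Sum>k\<in>?B. g (nat \<bar>k\<bar>))"
    by (simp add: sum.union_disjoint)
  also have "(\<Sum>k\<in>?A. g (nat \<bar>k\<bar>)) = (\<Sum>k=1..n. g k)"
    by (subst sum.reindex) (auto simp: inj_on_def)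
  also have "(\<Sum>k\<in>?B. g (nat \<bar>k\<bar>)) = (\<Sum>k=1..n. g k)"
    by (subst sum.reindex) (auto simp: inj_on_def)
  finally show ?thesis by simp
qed

text \<open>
  Opposite multiples \<open>k\<close> and \<open>- k\<close> of a move occur equally often; this is the factor 2. The range
  \<open>k \<le> n\<close> is generous: truncated subtraction makes the summands with \<open>k \<cdot> d_hat m > n\<close>,
  which correspond to displacements that do not fit on the board, vanish.
\<close>

lemma card_attacking_pairs:
  assumes M: "rider_moves M"
  shows "card {(z, z') \<in> board n \<times> board n. attacks M z z'} =
    n ^ 2 + (\<Sum>m\<in>M. 2 * (\<Sum>k=1..n. (n - k * c_hat m) * (n - k * d_hat m)))"
proof -
  let ?K = "{- int n..int n} - {0}"
  let ?D = "\<lambda>(m, k). displaced_pairs n (k * fst m) (k * snd m)"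
  have finM: "finite M" and neM: "M \<noteq> {}" using M by (auto simp: rider_moves_def)
  have decomp: "{(z, z') \<in> board n \<times> board n. attacks M z z'} =
      Id_on (board n) \<union> (\<Union>p\<in>M \<times> ?K. ?D p)" (is "?L = ?R")
  proof
    show "?L \<subseteq> ?R"
    proof
      fix p assume "p \<in> ?L"
      then obtain z z' m k where p: "p = (z, z')" "z \<in> board n" "z' \<in> board n" and m: "m \<in> M"
        and k: "fst z' - fst z = k * fst m" "snd z' - snd z = k * snd m"
        unfolding attacks_def by fastforce
      show "p \<in> ?R"
      proof (cases "k = 0")
        case True
        then have "z = z'" using k by (simp add: prod_eq_iff)
        then show ?thesis using p by auto
      next
        case False
        have pos: "\<bar>fst m\<bar> \<ge> 1 \<or> \<bar>snd m\<bar> \<ge> 1"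
          using d_hat_pos[OF M m] by (auto simp: d_hat_def)
        have "\<bar>k * fst m\<bar> \<le> int n" "\<bar>k * snd m\<bar> \<le> int n"
          unfolding k[symmetric] using p by (auto simp: board_def)
        moreover have "\<bar>k\<bar> \<le> \<bar>k * a\<bar>" if "\<bar>a\<bar> \<ge> 1" for a
          using mult_left_mono[OF that, of "\<bar>k\<bar>"] by (simp add: abs_mult)
        ultimately have "\<bar>k\<bar> \<le> int n" using pos by (meson order_trans)
        then have "(m, k) \<in> M \<times> ?K" using m False by auto
        moreover have "p \<in> ?D (m, k)" using p k by (simp add: displaced_pairs_def)
        ultimately show ?thesis by blast
      qed
    qed
    have "displaced_pairs n (k * fst m) (k * snd m) \<subseteq> ?L" if "m \<in> M" for m k
      using that unfolding displaced_pairs_def attacks_def by fastforce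
    moreover have "Id_on (board n) \<subseteq> ?L" using attacks_refl[OF neM] by auto
    ultimately show "?R \<subseteq> ?L" by auto
  qed
  have off_diagonal: "\<not> (k * fst m = 0 \<and> k * snd m = 0)" if "m \<in> M" "k \<noteq> 0" for m k
    using d_hat_pos[OF M that(1)] that(2) by (auto simp: d_hat_def)
  have "card ?L = card (Id_on (board n)) + card (\<Union>p\<in>M \<times> ?K. ?D p)"
    unfolding decomp
  proof (rule card_Un_disjoint)
    show "finite (Id_on (board n))" by (simp add: Id_on_def)
    show "finite (\<Union>p\<in>M \<times> ?K. ?D p)" using finM by auto
    show "Id_on (board n) \<inter> (\<Union>p\<in>M \<times> ?K. ?D p) = {}"
      \<comment> \<open>The instance rules out the zero vector as a move.\<close>
      using off_diagonal off_diagonal[of "(0, 0)" 1] by (auto simp: displaced_pairs_def)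
  qed
  also have "card (Id_on (board n)) = n ^ 2"
  proof -
    have "Id_on (board n) = (\<lambda>z. (z, z)) ` board n" by (auto simp: Id_on_def)
    then show ?thesis by (simp add: card_image inj_on_def)
  qed
  also have "card (\<Union>p\<in>M \<times> ?K. ?D p) = (\<Sum>p\<in>M \<times> ?K. card (?D p))"
  proof (rule card_UN_disjoint)
    show "finite (M \<times> ?K)" using finM by simp
    show "\<forall>p\<in>M \<times> ?K. finite (?D p)" by auto
    show "\<forall>p\<in>M \<times> ?K. \<forall>q\<in>M \<times> ?K. p \<noteq> q \<longrightarrow> ?D p \<inter> ?D q = {}"
    proof (intro ballI impI)
      fix p q assume pq: "p \<in> M \<times> ?K" "q \<in> M \<times> ?K" "p \<noteq> q"
      show "?D p \<inter> ?D q = {}"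
        using pq multiples_of_moves_inj[OF M, of "fst p" "fst q" "snd p" "snd q"]
        by (auto simp: displaced_pairs_def prod_eq_iff)
    qed
  qed
  also have "\<dots> = (\<Sum>m\<in>M. \<Sum>k\<in>?K. card (?D (m, k)))"
    by (subst sum.cartesian_product) (simp add: case_prod_beta)
  also have "\<dots> = (\<Sum>m\<in>M. 2 * (\<Sum>k=1..n. (n - k * c_hat m) * (n - k * d_hat m)))"
    by (simp only: split_conv card_displaced_pairs_move
        sum_symmetric_interval[of "\<lambda>k. (n - k * c_hat _) * (n - k * d_hat _)"])
  finally show ?thesis .
qed

section \<open>The closed formula\<close>

lemma sum_product_of_lines:
  fixes x c d :: real
  shows "(\<Sum>k=1..q. (x - real k * c) * (x - real k * d)) =
    x ^ 2 * real q - x * (c + d) * (real q * (real q + 1)) / 2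
      + c * d * (real q * (real q + 1) * (2 * real q + 1)) / 6"
  by (induction q) (auto simp: field_simps power2_eq_square)

text \<open>
  Eliminating the quotient \<open>q\<close> in favour of the remainder \<open>r\<close> turns the power sums into a cubic in
  \<open>n\<close> whose coefficients depend on \<open>r\<close>. Multiplied by \<open>6 d\<^sup>2\<close>, this is a polynomial identity
  in \<open>c\<close>, \<open>d\<close>, \<open>q\<close> and \<open>r\<close>.
\<close>

lemma division_with_remainder_identity:
  fixes c d n q r :: real
  assumes d: "d \<noteq> 0" and n: "n = q * d + r"
  shows "n ^ 2 * q - n * (c + d) * (q * (q + 1)) / 2 + c * d * (q * (q + 1) * (2 * q + 1)) / 6 =
      (3 * d - c) / d ^ 2 * n ^ 3 / 6 - n ^ 2 / 2 + c * n / 6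
    + r * (d - r) * (d - c) / d ^ 2 * n / 2
    - c * (d - r) * (d - 2 * r) * r / d ^ 2 / 6" (is "?l = ?r")
proof -
  have "6 * d ^ 2 * ?r = (3 * d - c) * n ^ 3 - 3 * d ^ 2 * n ^ 2 + d ^ 2 * c * n
      + 3 * (r * (d - r) * (d - c)) * n - c * (d - r) * (d - 2 * r) * r"
    using d by (simp add: field_simps eval_nat_numeral)
  also have "\<dots> = 6 * d ^ 2 * (n ^ 2 * q) - 3 * d ^ 2 * (n * (c + d) * (q * (q + 1)))
      + d ^ 2 * (c * d * (q * (q + 1) * (2 * q + 1)))"
    unfolding n by algebra
  also have "\<dots> = 6 * d ^ 2 * ?l" by (simp add: field_simps)
  finally show ?thesis using d by simp
qed

text \<open>
  The sum stops effectively at \<open>n div d\<close>. Up to there both factors are genuine differences, since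
  \<open>c \<le> d\<close>, so the real closed form applies.
\<close>

lemma sum_displacements_closed_form:
  fixes n c d :: nat
  assumes d: "d > 0" and cd: "c \<le> d"
  defines "r \<equiv> real (n mod d)"
  shows "real (\<Sum>k=1..n. (n - k * c) * (n - k * d)) =
      (3 * real d - real c) / real d ^ 2 * real n ^ 3 / 6
    - real n ^ 2 / 2
    + real c * real n / 6
    + r * (real d - r) * (real d - real c) / real d ^ 2 * real n / 2
    - real c * (real d - r) * (real d - 2 * r) * r / real d ^ 2 / 6"
proof -
  define q where "q = n div d"
  have n: "real n = real q * real d + r"
    unfolding q_def r_def by (metis div_mult_mod_eq of_nat_add of_nat_mult)
  have "q \<le> n" unfolding q_def by (rule div_le_dividend)
  have le: "k * d \<le> n \<longleftrightarrow> k \<le> q" for k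
    using less_eq_div_iff_mult_less_eq[OF d] by (simp add: q_def)
  have "(\<Sum>k=1..n. (n - k * c) * (n - k * d)) = (\<Sum>k=1..q. (n - k * c) * (n - k * d))"
  proof (rule sum.mono_neutral_right)
    show "\<forall>k\<in>{1..n} - {1..q}. (n - k * c) * (n - k * d) = 0"
    proof
      fix k assume "k \<in> {1..n} - {1..q}"
      then have "\<not> k * d \<le> n" using le by auto
      then show "(n - k * c) * (n - k * d) = 0" by simp
    qed
  qed (use \<open>q \<le> n\<close> in auto)
  then have "real (\<Sum>k=1..n. (n - k * c) * (n - k * d)) =
      (\<Sum>k=1..q. real ((n - k * c) * (n - k * d)))" by simp
  also have "\<dots> = (\<Sum>k=1..q. (real n - real k * real c) * (real n - real k * real d))"
  proof (rule sum.cong)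
    fix k assume "k \<in> {1..q}"
    then have kd: "k * d \<le> n" using le by auto
    moreover have "k * c \<le> n" using kd cd mult_le_mono2 order_trans by blast
    ultimately show "real ((n - k * c) * (n - k * d)) =
        (real n - real k * real c) * (real n - real k * real d)"
      by (simp add: of_nat_diff)
  qed simp
  also have "\<dots> = real n ^ 2 * real q - real n * (real c + real d) * (real q * (real q + 1)) / 2
      + real c * real d * (real q * (real q + 1) * (2 * real q + 1)) / 6"
    by (rule sum_product_of_lines)
  also have "\<dots> = (3 * real d - real c) / real d ^ 2 * real n ^ 3 / 6
    - real n ^ 2 / 2
    + real c * real n / 6
    + r * (real d - r) * (real d - real c) / real d ^ 2 * real n / 2
    - real c * (real d - r) * (real d - 2 * r) * r / real d ^ 2 / 6"
    using d n by (intro division_with_remainder_identity) simp_all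
  finally show ?thesis .
qed

text \<open>
  The argument \<open>j\<close> supplies only the residues modulo the \<open>d_hat m\<close>; keeping it separate from the
  variable of the polynomial turns the formula for the count into a quasipolynomial. The
  coefficients are listed from degree 0 to degree 4.
\<close>

definition rider_constituent :: "(int \<times> int) set \<Rightarrow> nat \<Rightarrow> real poly" where
  "rider_constituent M j =
    [: 1 / 6 * (\<Sum>m\<in>M. real (c_hat m) * (real (d_hat m) - real (n_bar j m))
              * (real (d_hat m) - 2 * real (n_bar j m)) * real (n_bar j m) / real (d_hat m) ^ 2),
       - 1 / 6 * (\<Sum>m\<in>M. real (c_hat m))
       - 1 / 2 * (\<Sum>m\<in>M. real (n_bar j m) * (real (d_hat m) - real (n_bar j m))
              * (real (d_hat m) - real (c_hat m)) / real (d_hat m) ^ 2),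
       (real (card M) - 1) / 2,
       - 1 / 6 * (\<Sum>m\<in>M. (3 * real (d_hat m) - real (c_hat m)) / real (d_hat m) ^ 2),
       1 / 2 :]"

lemma u_count_2_eq_constituent:
  assumes M: "rider_moves M"
  shows "real (u_count M 2 n) = poly (rider_constituent M n) (real n)"
proof -
  let ?B = "board n \<times> board n"
  let ?S = "\<lambda>m. \<Sum>k=1..n. (n - k * c_hat m) * (n - k * d_hat m)"
  have neM: "M \<noteq> {}" using M by (simp add: rider_moves_def)
  have "card ?B = card {(z, z') \<in> ?B. attacks M z z'} + card {(z, z') \<in> ?B. \<not> attacks M z z'}"
    by (subst card_Un_disjoint[symmetric])
       (force intro: finite_subset[of _ ?B] intro!: arg_cong[of _ _ card])+
  then have "n ^ 4 = card {(z, z') \<in> ?B. attacks M z z'} + o_count M 2 n"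
    by (simp add: o_count_2 card_cartesian_product flip: power_add)
  then have "n ^ 4 = n ^ 2 + 2 * (\<Sum>m\<in>M. ?S m) + 2 * u_count M 2 n"
    unfolding card_attacking_pairs[OF M] o_count_2_eq_twice_u_count_2[OF neM]
    by (simp add: sum_distrib_left)
  then have "real (n ^ 4) = real (n ^ 2 + 2 * (\<Sum>m\<in>M. ?S m) + 2 * u_count M 2 n)"
    by (rule arg_cong)
  then have "real (u_count M 2 n) = real n ^ 4 / 2 - real n ^ 2 / 2 - (\<Sum>m\<in>M. real (?S m))"
    by (simp add: add_divide_distrib)
  also have "(\<Sum>m\<in>M. real (?S m)) = (\<Sum>m\<in>M.
      (3 * real (d_hat m) - real (c_hat m)) / real (d_hat m) ^ 2 * real n ^ 3 / 6
    - real n ^ 2 / 2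
    + real (c_hat m) * real n / 6
    + real (n_bar n m) * (real (d_hat m) - real (n_bar n m))
        * (real (d_hat m) - real (c_hat m)) / real (d_hat m) ^ 2 * real n / 2
    - real (c_hat m) * (real (d_hat m) - real (n_bar n m))
        * (real (d_hat m) - 2 * real (n_bar n m)) * real (n_bar n m) / real (d_hat m) ^ 2 / 6)"
    unfolding n_bar_def
    by (rule sum.cong[OF refl], rule sum_displacements_closed_form)
       (use d_hat_pos[OF M] c_hat_le_d_hat in auto)
  finally show ?thesis
    unfolding rider_constituent_def
    by (simp only: sum.distrib sum_subtractf flip: sum_divide_distrib sum_distrib_right)
       (simp add: algebra_simps power2_eq_square power3_eq_cube power4_eq_xxxx add_divide_distrib diff_divide_distrib)
qed

section \<open>The period\<close>

lemma rider_constituent_cong: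
  assumes "\<And>m. m \<in> M \<Longrightarrow> i mod d_hat m = j mod d_hat m"
  shows "rider_constituent M i = rider_constituent M j"
  using assms by (simp add: rider_constituent_def n_bar_def)

text \<open>
  The argument \<open>n\<close> can run through infinitely many numbers that agree with \<open>j\<close> modulo both cycle
  lengths \<open>L\<close> and \<open>p\<close>. On them the two constituents of \<open>j\<close> take the same values, so they are the
  same polynomial.
\<close>

lemma quasipoly_constituents_unique:
  fixes Q :: "nat \<Rightarrow> real poly"
  assumes f: "\<And>n. n \<ge> 1 \<Longrightarrow> f n = poly (Q n) (real n)"
    and per: "\<And>j k. Q (j + L * k) = Q j" and L: "L > 0"
    and P: "\<And>n. n \<ge> 1 \<Longrightarrow> f n = poly (P (n mod p)) (real n)" and p: "p > 0"
  shows "Q j = P (j mod p)"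
proof (rule ccontr)
  assume "Q j \<noteq> P (j mod p)"
  then have "finite {x. poly (Q j - P (j mod p)) x = 0}"
    by (intro poly_roots_finite) simp
  moreover have "range (\<lambda>k. real (j + L * p * Suc k)) \<subseteq> {x. poly (Q j - P (j mod p)) x = 0}"
  proof safe
    fix k
    \<comment> \<open>\<open>Suc k\<close> rather than \<open>k\<close> keeps the argument positive also for \<open>j = 0\<close>.\<close>
    let ?n = "j + L * p * Suc k"
    have "?n \<ge> 1" using L p by (simp add: Suc_le_eq)
    moreover have "Q ?n = Q j" using per[of j "p * Suc k"] by (simp only: mult.assoc)
    moreover have "?n mod p = j mod p"
      by (metis mod_mult_self2 mult.assoc mult.left_commute)
    ultimately have "poly (Q j) (real ?n) = poly (P (j mod p)) (real ?n)"
      using f[of ?n] P[of ?n] by simp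
    then show "poly (Q j - P (j mod p)) (real ?n) = 0" by simp
  qed
  ultimately have "finite (range (\<lambda>k. real (j + L * p * Suc k)))" by (rule finite_subset[rotated])
  moreover have "inj (\<lambda>k. real (j + L * p * Suc k))"
    using L p by (auto simp: inj_on_def)
  ultimately show False using finite_imageD by blast
qed

text \<open>
  At residue 0 the periodic part of the linear coefficient is 0. At \<open>p\<close> it is a sum of
  nonnegative terms, so each term is 0; as \<open>c_hat m < d_hat m\<close> unless \<open>d_hat m = 1\<close>, this
  forces the remainder of \<open>p\<close> modulo \<open>d_hat m\<close> to be 0.
\<close>

lemma d_hat_dvd_if_constituent_eq:
  assumes M: "rider_moves M" and m: "m \<in> M"
    and eq: "rider_constituent M p = rider_constituent M 0"
  shows "d_hat m dvd p"
proof (cases "d_hat m = 1")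
  case False
  let ?t = "\<lambda>m. real (n_bar p m) * (real (d_hat m) - real (n_bar p m))
              * (real (d_hat m) - real (c_hat m)) / real (d_hat m) ^ 2"
  have "finite M" using M by (simp add: rider_moves_def)
  have lt: "n_bar p m' < d_hat m'" if "m' \<in> M" for m'
    using d_hat_pos[OF M that] by (simp add: n_bar_def)
  have nonneg: "?t m' \<ge> 0" if "m' \<in> M" for m'
    using lt[OF that] c_hat_le_d_hat[of m'] by (intro divide_nonneg_nonneg mult_nonneg_nonneg) auto
  have "coeff (rider_constituent M p) 1 = coeff (rider_constituent M 0) 1" using eq by simp
  then have "(\<Sum>m\<in>M. ?t m) = 0" by (simp add: rider_constituent_def n_bar_def)
  then have "?t m = 0" using sum_nonneg_eq_0_iff[OF \<open>finite M\<close>, of ?t] nonneg m by blast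
  then have "n_bar p m = 0"
    using lt[OF m] c_hat_less_d_hat[OF M m False] by auto
  then show ?thesis by (simp add: n_bar_def dvd_eq_mod_eq_0)
qed simp

lemma u_count_2_period:
  assumes M: "rider_moves M"
  shows "has_quasipoly_period (\<lambda>n. real (u_count M 2 n)) (Lcm (d_hat ` M))"
proof -
  define L where "L = Lcm (d_hat ` M)"
  have "finite M" using M by (simp add: rider_moves_def)
  have dvd: "d_hat m dvd L" if "m \<in> M" for m using that by (simp add: L_def dvd_Lcm)
  have "0 \<notin> d_hat ` M" using d_hat_pos[OF M] by force
  then have L: "L > 0"
    using \<open>finite M\<close> by (auto simp: L_def Lcm_0_iff_nat intro!: Nat.gr0I)
  have "quasipoly_cycle (\<lambda>n. real (u_count M 2 n)) L"
    unfolding quasipoly_cycle_def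
  proof (intro conjI exI allI impI)
    show "L \<ge> 1" using L by simp
    fix n
    have "rider_constituent M (n mod L) = rider_constituent M n"
      by (rule rider_constituent_cong) (simp add: dvd mod_mod_cancel)
    then show "real (u_count M 2 n) = poly (rider_constituent M (n mod L)) (real n)"
      using u_count_2_eq_constituent[OF M] by simp
  qed
  moreover have "L \<le> p" if cycle: "quasipoly_cycle (\<lambda>n. real (u_count M 2 n)) p" for p
  proof -
    obtain P where p: "p \<ge> 1"
      and P: "\<And>n. n \<ge> 1 \<Longrightarrow> real (u_count M 2 n) = poly (P (n mod p)) (real n)"
      using cycle unfolding quasipoly_cycle_def by blast
    have "rider_constituent M (j + L * k) = rider_constituent M j" for j k
      by (rule rider_constituent_cong) (metis dvd dvd_mult2 mod_add_right_eq add.right_neutral dvd_imp_mod_0)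
    then have "rider_constituent M j = P (j mod p)" for j
      using quasipoly_constituents_unique[of "\<lambda>n. real (u_count M 2 n)" "rider_constituent M" L P p j]
        u_count_2_eq_constituent[OF M] P L p by simp
    \<comment> \<open>Both \<open>p\<close> and \<open>0\<close> have remainder 0 modulo \<open>p\<close>.\<close>
    from this[of p] this[of 0] have "rider_constituent M p = rider_constituent M 0" by simp
    then have "d_hat m dvd p" if "m \<in> M" for m
      using d_hat_dvd_if_constituent_eq[OF M that] by blast
    then have "L dvd p" unfolding L_def by (auto intro: Lcm_least)
    then show ?thesis using p by (intro dvd_imp_le) auto
  qed
  ultimately show ?thesis unfolding has_quasipoly_period_def L_def by blast
qed

theorem theorem3p1:
  fixes M :: "(int \<times> int) set"
  assumes "rider_moves M"
  shows "(\<forall>n\<ge>1.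
      real (u_count M 2 n) = 1 / fact 2 * real (o_count M 2 n) \<and>
      1 / fact 2 * real (o_count M 2 n) =
          1 / 2 * real n ^ 4
        - 1 / 6 * (\<Sum>m\<in>M. (3 * real (d_hat m) - real (c_hat m)) / real (d_hat m) ^ 2) * real n ^ 3
        + (real (card M) - 1) / 2 * real n ^ 2
        - 1 / 6 * (\<Sum>m\<in>M. real (c_hat m)) * real n
        - 1 / 2 * (\<Sum>m\<in>M. real (n_bar n m) * (real (d_hat m) - real (n_bar n m))
              * (real (d_hat m) - real (c_hat m)) / real (d_hat m) ^ 2) * real n
        + 1 / 6 * (\<Sum>m\<in>M. real (c_hat m) * (real (d_hat m) - real (n_bar n m))
              * (real (d_hat m) - 2 * real (n_bar n m)) * real (n_bar n m) / real (d_hat m) ^ 2))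
    \<and> has_quasipoly_period (\<lambda>n. real (u_count M 2 n)) (Lcm (d_hat ` M))"
proof -
  have "M \<noteq> {}" using assms by (simp add: rider_moves_def)
  then have half: "real (u_count M 2 n) = 1 / fact 2 * real (o_count M 2 n)" for n
    by (simp add: o_count_2_eq_twice_u_count_2)
  show ?thesis
    unfolding half[symmetric]
    by (intro conjI allI impI u_count_2_period[OF assms] refl)
       (simp add: u_count_2_eq_constituent[OF assms] rider_constituent_def
          algebra_simps power2_eq_square power3_eq_cube power4_eq_xxxx)
qed

end
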